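(* Assume that $\mathcal A$ is compact; that for each $\xi\in\Xi$, $\mathcal C(s,a,\xi)$ and $g(s,a,\xi)$ are continuous in $(s,a)$; and that there are constants $\bar{\mathcal C}_w>0$, $\kappa_w\ge0$ such that $|\mathcal C(s,a,\xi)|\le\bar{\mathcal C}_ww(s)$ and $w(g(s,a,\xi))\le\kappa_ww(s)$ for all $(s,a,\xi)\in\mathcal S\times\mathcal A\times\Xi$, with $\gamma\kappa_w<1$. Then the unique fixed point $\hat V_N^*\in\mathscr V(\mathcal S)$ of $\hat{\mathcal L}_N$ converges to the true optimal value function $V^*$ (the unique fixed point of $\mathcal L$ in $\mathscr V(\mathcal S)$) in the weighted supremum norm: $$\lim_{N\to\infty}\|\hat V_N^*-V^*\|_w=0\quad\text{almost surely.}$$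
   Context: $\mathcal S\subseteq\mathbb R^m$ and $\mathcal A\subseteq\mathbb R^n$ are nonempty closed sets; $\Xi=\{\xi^1,\dots,\xi^J\}\subseteq\mathbb R^k$ is a finite set of $J$ distinct points; $\mathscr P(\Xi)$ is the set of probability measures on $\Xi$, identified with the probability vectors $\{P=(p_j)_{j=1}^J\in[0,1]^J:\sum_{j=1}^Jp_j=1\}$ via $p_j=P(\xi=\xi^j)$. $\mathcal C:\mathcal S\times\mathcal A\times\Xi\to\mathbb R$ is the cost, $g:\mathcal S\times\mathcal A\times\Xi\to\mathcal S$ the transition function, $\gamma\in[0,1)$ the discount factor, and $P^c\in\mathscr P(\Xi)$ the true distribution. Bayesian ambiguity set: prior parameters $\tau_{j,0}>1$ are given; $\hat\xi_1,\hat\xi_2,\dots$ are i.i.d. from $P^c$ (almost sure statements refer to this sequence); $\tau_{j,N}=\tau_{j,0}+\sum_{i=1}^N\mathbf 1_{\{\hat\xi_i=\xi^j\}}$. Fix $\alpha\in(0,1)$, $\alpha'=\alpha/J$, and let $z_{1-\alpha'/2}$ be the $(1-\alpha'/2)$-quantile of the standard normal distribution. Then $$\hat p_{j,N}=\frac{\tau_{j,N}-1}{\sum_{k=1}^J\tau_{k,N}-J},\qquad \hat r_{j,N}=z_{1-\alpha'/2}\sqrt{\frac{\hat p_{j,N}(1-\hat p_{j,N})}{\sum_{k=1}^J\tau_{k,N}-J}},$$ $\hat P_N=(\hat p_{j,N})_j$, $\hat r_N=(\hat r_{j,N})_j$, and $\mathfrak P(P,r)=\{Q\in\mathscr P(\Xi):p_j-r_j\le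 q_j\le p_j+r_j,\ j=1,\dots,J\}$. Weighted norm: $w:\mathcal S\to[1,\infty)$ is a fixed continuous function, $\|V\|_w=\sup_{s\in\mathcal S}|V(s)|/w(s)$, and $\mathscr V(\mathcal S)=\{V:\mathcal S\to\mathbb R:\|V\|_w<\infty\}$. Bellman operators on $\mathscr V(\mathcal S)$: $$\mathcal L(V)(s)=\inf_{a\in\mathcal A}\mathbb E_{P^c}[\mathcal C(s,a,\xi)+\gamma V(g(s,a,\xi))],\qquad \hat{\mathcal L}_N(V)(s)=\inf_{a\in\mathcal A}\sup_{P\in\mathfrak P(\hat P_N,\hat r_N)}\mathbb E_P[\mathcal C(s,a,\xi)+\gamma V(g(s,a,\xi))].$$ Under the hypotheses of the claim these are contractions of $(\mathscr V(\mathcal S),\|\cdot\|_w)$, hence have unique fixed points. *)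

theory Defs
  imports "HOL-Probability.Probability"
begin

text \<open>
  The support is the range of an injective family \<open>\<xi> :: 'j \<Rightarrow> real ^ 'k\<close> over a finite type
  \<open>'j\<close>, so that \<open>J = CARD('j)\<close>. A probability measure on it is its vector of point masses.
\<close>

definition prob_vectors :: "(real ^ 'j) set" where
  "prob_vectors = {P. (\<forall>j. 0 \<le> P $ j \<and> P $ j \<le> 1) \<and> (\<Sum>j\<in>UNIV. P $ j) = 1}"

definition expect :: "('j \<Rightarrow> 'x) \<Rightarrow> real ^ 'j \<Rightarrow> ('x \<Rightarrow> real) \<Rightarrow> real" where
  "expect \<xi> P f = (\<Sum>j\<in>UNIV. P $ j * f (\<xi> j))"

definition std_normal_quantile :: "real \<Rightarrow> real" where
  "std_normal_quantile q = Inf {x. q \<le> cdf std_normal_distribution x}"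

text \<open>The observations are \<open>X 1, X 2, \<dots>\<close>; the value \<open>X 0\<close> plays no role.\<close>

definition post_param ::
  "('j \<Rightarrow> 'x) \<Rightarrow> ('j \<Rightarrow> real) \<Rightarrow> (nat \<Rightarrow> 'w \<Rightarrow> 'x) \<Rightarrow> nat \<Rightarrow> 'w \<Rightarrow> 'j \<Rightarrow> real" where
  "post_param \<xi> \<tau>0 X N \<omega> j = \<tau>0 j + (\<Sum>i=1..N. if X i \<omega> = \<xi> j then 1 else 0)"

definition p_hat ::
  "('j::finite \<Rightarrow> 'x) \<Rightarrow> ('j \<Rightarrow> real) \<Rightarrow> (nat \<Rightarrow> 'w \<Rightarrow> 'x) \<Rightarrow> nat \<Rightarrow> 'w \<Rightarrow> real ^ 'j" where
  "p_hat \<xi> \<tau>0 X N \<omega> =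
     (\<chi> j. (post_param \<xi> \<tau>0 X N \<omega> j - 1) /
          ((\<Sum>k\<in>UNIV. post_param \<xi> \<tau>0 X N \<omega> k) - real CARD('j)))"

definition r_hat ::
  "real \<Rightarrow> ('j::finite \<Rightarrow> 'x) \<Rightarrow> ('j \<Rightarrow> real) \<Rightarrow> (nat \<Rightarrow> 'w \<Rightarrow> 'x) \<Rightarrow> nat \<Rightarrow> 'w \<Rightarrow> real ^ 'j" where
  "r_hat \<alpha> \<xi> \<tau>0 X N \<omega> =
     (\<chi> j. std_normal_quantile (1 - (\<alpha> / real CARD('j)) / 2) *
          sqrt (p_hat \<xi> \<tau>0 X N \<omega> $ j * (1 - p_hat \<xi> \<tau>0 X N \<omega> $ j) /
                ((\<Sum>k\<in>UNIV. post_param \<xi> \<tau>0 X N \<omega> k) - real CARD('j))))"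

definition ambiguity_set :: "real ^ 'j \<Rightarrow> real ^ 'j \<Rightarrow> (real ^ 'j) set" where
  "ambiguity_set P r =
     {Q \<in> prob_vectors. \<forall>j. P $ j - r $ j \<le> Q $ j \<and> Q $ j \<le> P $ j + r $ j}"

text \<open>
  Functions on \<open>S\<close> are represented by their extensional representatives, so that equality of
  value functions, and hence uniqueness of fixed points, refers to values on \<open>S\<close> only.
  On \<open>weighted_space S w\<close> the real-valued supremum in \<open>wnorm\<close> is over a bounded set.
\<close>

definition wnorm :: "'s set \<Rightarrow> ('s \<Rightarrow> real) \<Rightarrow> ('s \<Rightarrow> real) \<Rightarrow> real" where
  "wnorm S w V = (SUP s\<in>S. \<bar>V s\<bar> / w s)"

definition weighted_space :: "'s set \<Rightarrow> ('s \<Rightarrow> real) \<Rightarrow> ('s \<Rightarrow> real) set" where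
  "weighted_space S w = {V \<in> extensional S. bdd_above ((\<lambda>s. \<bar>V s\<bar> / w s) ` S)}"

definition bellman ::
  "'s set \<Rightarrow> 'a set \<Rightarrow> ('j \<Rightarrow> 'x) \<Rightarrow> ('s \<Rightarrow> 'a \<Rightarrow> 'x \<Rightarrow> real) \<Rightarrow> ('s \<Rightarrow> 'a \<Rightarrow> 'x \<Rightarrow> 's) \<Rightarrow> real \<Rightarrow>
   real ^ 'j \<Rightarrow> ('s \<Rightarrow> real) \<Rightarrow> ('s \<Rightarrow> real)" where
  "bellman S A \<xi> C g \<gamma> P V =
     (\<lambda>s\<in>S. INF a\<in>A. expect \<xi> P (\<lambda>x. C s a x + \<gamma> * V (g s a x)))"

definition robust_bellman ::
  "'s set \<Rightarrow> 'a set \<Rightarrow> ('j \<Rightarrow> 'x) \<Rightarrow> ('s \<Rightarrow> 'a \<Rightarrow> 'x \<Rightarrow> real) \<Rightarrow> ('s \<Rightarrow> 'a \<Rightarrow> 'x \<Rightarrow> 's) \<Rightarrow> real \<Rightarrow>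
   (real ^ 'j) set \<Rightarrow> ('s \<Rightarrow> real) \<Rightarrow> ('s \<Rightarrow> real)" where
  "robust_bellman S A \<xi> C g \<gamma> Q V =
     (\<lambda>s\<in>S. INF a\<in>A. SUP P\<in>Q. expect \<xi> P (\<lambda>x. C s a x + \<gamma> * V (g s a x)))"

definition bayes_bellman ::
  "'s set \<Rightarrow> 'a set \<Rightarrow> ('j::finite \<Rightarrow> 'x) \<Rightarrow> ('s \<Rightarrow> 'a \<Rightarrow> 'x \<Rightarrow> real) \<Rightarrow> ('s \<Rightarrow> 'a \<Rightarrow> 'x \<Rightarrow> 's) \<Rightarrow> real \<Rightarrow>
   real \<Rightarrow> ('j \<Rightarrow> real) \<Rightarrow> (nat \<Rightarrow> 'w \<Rightarrow> 'x) \<Rightarrow> nat \<Rightarrow> 'w \<Rightarrow> ('s \<Rightarrow> real) \<Rightarrow> ('s \<Rightarrow> real)" where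
  "bayes_bellman S A \<xi> C g \<gamma> \<alpha> \<tau>0 X N \<omega> =
     robust_bellman S A \<xi> C g \<gamma> (ambiguity_set (p_hat \<xi> \<tau>0 X N \<omega>) (r_hat \<alpha> \<xi> \<tau>0 X N \<omega>))"

text \<open>Meaningful only when the fixed point in \<open>weighted_space S w\<close> exists and is unique.\<close>

definition fixed_point ::
  "'s set \<Rightarrow> ('s \<Rightarrow> real) \<Rightarrow> (('s \<Rightarrow> real) \<Rightarrow> ('s \<Rightarrow> real)) \<Rightarrow> ('s \<Rightarrow> real)" where
  "fixed_point S w T = (THE V. V \<in> weighted_space S w \<and> T V = V)"

end

theory Submission
  imports Defs
begin

text \<open>
  Each robust operator with a nonempty ambiguity set is a contraction with modulus \<open>\<gamma> * \<kappa>\<close>, and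
  its fixed point moves at most linearly in the largest \<open>\<ell>\<^sub>1\<close>-distance \<open>\<delta>\<close> between the ambiguity set
  and the true distribution: comparing both operators at the true value function \<open>V\<close> gives the bound
  \<open>\<delta> * (Cw + \<gamma> * \<kappa> * wnorm S w V) / (1 - \<gamma> * \<kappa>)\<close>. Almost surely \<open>\<delta>\<close> tends to \<open>0\<close>, because the
  posterior modes \<open>p_hat\<close> follow the empirical frequencies (strong law, here from Hoeffding's
  inequality and Borel--Cantelli) and the radii \<open>r_hat\<close> are of order \<open>1 / sqrt N\<close>. The ambiguity sets
  are nonempty because the quantile defining the radii lies above the median and is thus nonnegative.
\<close>

section \<open>A strong law for bounded variables\<close>

text \<open>Hoeffding makes the probability of a deviation by at least \<open>\<epsilon>\<close>
  decay geometrically in the number of terms, hence summable, and Borel-Cantelli excludes infinitely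
  many such deviations almost surely.\<close>

lemma (in prob_space) strong_law_bounded:
  fixes Y :: "nat \<Rightarrow> 'a \<Rightarrow> real"
  assumes indep: "indep_vars (\<lambda>_. borel) Y {1..}"
    and bounds: "\<And>i. i \<ge> 1 \<Longrightarrow> AE \<omega> in M. Y i \<omega> \<in> {a..b}" and "a < b"
    and mean: "\<And>i. i \<ge> 1 \<Longrightarrow> expectation (Y i) = \<mu>"
  shows "AE \<omega> in M. (\<lambda>N. (\<Sum>i=1..N. Y i \<omega>) / real N) \<longlonglongrightarrow> \<mu>"
proof -
  have [measurable]: "random_variable borel (Y i)" if "i \<ge> 1" for i
    using indep that by (auto simp: indep_vars_def)
  have eps: "AE \<omega> in M. \<forall>\<^sub>F N in sequentially. \<bar>(\<Sum>i=1..Suc N. Y i \<omega>) / real (Suc N) - \<mu>\<bar> < \<epsilon>"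
    if "\<epsilon> > 0" for \<epsilon>
  proof -
    \<comment> \<open>Indexing by \<open>Suc N\<close> keeps the number of summands positive, both
      in Hoeffding's bound and when dividing by it. Scaling the deviation by \<open>Suc N\<close>
      makes the exponent linear in \<open>Suc N\<close>, so that the bound is a power of
      \<open>q\<close>.\<close>
    define B where
      "B N = {\<omega> \<in> space M. \<bar>(\<Sum>i=1..Suc N. Y i \<omega>) - real (Suc N) * \<mu>\<bar> \<ge> real (Suc N) * \<epsilon>}" for N
    define q where "q = exp (- 2 * \<epsilon>\<^sup>2 / (b - a)\<^sup>2)"
    have "0 < q" "q < 1"
      using \<open>\<epsilon> > 0\<close> \<open>a < b\<close> by (auto simp: q_def)
    have prob_B: "prob (B N) \<le> 2 * q ^ Suc N" for N
    proof -
      interpret H: Hoeffding_ineq M "{1..Suc N}" Y "\<lambda>_. a" "\<lambda>_. b" "real (Suc N) * \<mu>"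
      proof unfold_locales
        show "indep_vars (\<lambda>_. borel) Y {1..Suc N}"
          by (rule indep_vars_subset[OF indep]) auto
        show "real (Suc N) * \<mu> \<equiv> (\<Sum>i = 1..Suc N. expectation (Y i))"
          by (simp add: mean)
      qed (use bounds in auto)
      have "prob (B N) \<le> 2 * exp (- 2 * (real (Suc N) * \<epsilon>)\<^sup>2 / (\<Sum>i=1..Suc N. (b - a)\<^sup>2))"
        unfolding B_def using \<open>\<epsilon> > 0\<close> \<open>a < b\<close> by (intro H.Hoeffding_ineq_abs_ge) auto
      also have "- 2 * (real (Suc N) * \<epsilon>)\<^sup>2 / (\<Sum>i=1..Suc N. (b - a)\<^sup>2)
          = real (Suc N) * (- 2 * \<epsilon>\<^sup>2 / (b - a)\<^sup>2)"
        using \<open>a < b\<close> by (simp add: divide_simps power2_eq_square)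
      also have "2 * exp \<dots> = 2 * q ^ Suc N"
        unfolding q_def by (metis exp_of_nat_mult)
      finally show ?thesis .
    qed
    have "AE \<omega> in M. \<forall>\<^sub>F N in sequentially. \<omega> \<in> space M - B N"
    proof (rule borel_cantelli_AE1)
      show "B N \<in> sets M" for N
        unfolding B_def by measurable
      show "emeasure M (B N) < \<infinity>" for N
        by (simp add: less_top[symmetric])
      have "summable (\<lambda>N. 2 * q ^ Suc N)"
        using \<open>0 < q\<close> \<open>q < 1\<close> by (intro summable_mult) (subst summable_Suc_iff, simp add: summable_geometric)
      then show "summable (\<lambda>N. prob (B N))"
        by (rule summable_comparison_test') (use prob_B in auto)
    qed
    then show ?thesis
    proof (rule AE_mp, intro AE_I2 impI)
      fix \<omega> assume \<omega>: "\<omega> \<in> space M" and ev: "\<forall>\<^sub>F N in sequentially. \<omega> \<in> space M - B N"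
      show "\<forall>\<^sub>F N in sequentially. \<bar>(\<Sum>i=1..Suc N. Y i \<omega>) / real (Suc N) - \<mu>\<bar> < \<epsilon>"
        using ev
      proof eventually_elim
        case (elim N)
        then have "\<bar>(\<Sum>i=1..Suc N. Y i \<omega>) - real (Suc N) * \<mu>\<bar> < real (Suc N) * \<epsilon>"
          using \<omega> by (auto simp: B_def)
        moreover have "(\<Sum>i=1..Suc N. Y i \<omega>) / real (Suc N) - \<mu>
            = ((\<Sum>i=1..Suc N. Y i \<omega>) - real (Suc N) * \<mu>) / real (Suc N)"
          by (simp add: divide_simps)
        ultimately show ?case
          by (simp add: pos_divide_less_eq mult.commute del: sum.cl_ivl_Suc of_nat_Suc)
      qed
    qed
  qed
  \<comment> \<open>The exceptional null set depends on \<open>\<epsilon>\<close>; restricting to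
    the countably many values 1 / (k + 1) gives a single null set that serves all
    tolerances.\<close>
  have "AE \<omega> in M. \<forall>k. \<forall>\<^sub>F N in sequentially.
      \<bar>(\<Sum>i=1..Suc N. Y i \<omega>) / real (Suc N) - \<mu>\<bar> < inverse (real (Suc k))"
    by (subst AE_all_countable) (intro allI eps, simp)
  then show ?thesis
  proof (rule AE_mp, intro AE_I2 impI)
    fix \<omega> assume lim: "\<forall>k. \<forall>\<^sub>F N in sequentially.
      \<bar>(\<Sum>i=1..Suc N. Y i \<omega>) / real (Suc N) - \<mu>\<bar> < inverse (real (Suc k))"
    have "(\<lambda>N. (\<Sum>i=1..Suc N. Y i \<omega>) / real (Suc N)) \<longlonglongrightarrow> \<mu>"
    proof (rule tendstoI)
      fix e :: real assume "e > 0"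
      then obtain k where "inverse (real (Suc k)) < e"
        using reals_Archimedean by blast
      then show "\<forall>\<^sub>F N in sequentially. dist ((\<Sum>i=1..Suc N. Y i \<omega>) / real (Suc N)) \<mu> < e"
        using lim[rule_format, of k] by (auto simp: dist_real_def elim!: eventually_mono)
    qed
    then show "(\<lambda>N. (\<Sum>i=1..N. Y i \<omega>) / real N) \<longlonglongrightarrow> \<mu>"
      by (rule LIMSEQ_imp_Suc)
  qed
qed

section \<open>The normal quantile\<close>

text \<open>The density is even, so \<open>{..x}\<close> and \<open>{- x..}\<close> have equal mass;
  for negative \<open>x\<close> they are disjoint, and their masses add up to at most 1.\<close>

lemma cdf_std_normal_le_half:
  assumes "x < 0"
  shows "cdf std_normal_distribution x \<le> 1 / 2"
proof -
  interpret real_distribution std_normal_distribution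
    by (rule real_dist_normal_dist)
  have "emeasure std_normal_distribution {..x}
      = (\<integral>\<^sup>+ y. ennreal (std_normal_density y) * indicator {..x} y \<partial>lborel)"
    by (simp add: emeasure_density)
  also have "\<dots> = (\<integral>\<^sup>+ y. ennreal (std_normal_density (- y)) * indicator {..x} (- y) \<partial>lborel)"
    by (subst nn_integral_real_affine[where c = "-1" and t = 0]) auto
  also have "\<dots> = (\<integral>\<^sup>+ y. ennreal (std_normal_density y) * indicator {- x..} y \<partial>lborel)"
    by (intro nn_integral_cong) (auto simp: std_normal_density_def indicator_def)
  also have "\<dots> = emeasure std_normal_distribution {- x..}"
    by (simp add: emeasure_density)
  finally have sym: "prob {- x..} = prob {..x}"
    by (simp add: measure_def)
  have "prob {..x} + prob {- x..} = prob ({..x} \<union> {- x..})"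
    using assms by (intro finite_measure_Union[symmetric]) auto
  also have "\<dots> \<le> 1"
    by (rule prob_le_1)
  finally show ?thesis
    by (simp add: cdf_def sym)
qed

text \<open>No negative point reaches a level above 1/2. The condition \<open>q < 1\<close> makes
  the set under the infimum nonempty; the real \<open>Inf\<close> of an empty set would carry no
  information.\<close>

lemma std_normal_quantile_nonneg:
  assumes "1 / 2 < q" "q < 1"
  shows "0 \<le> std_normal_quantile q"
  unfolding std_normal_quantile_def
proof (rule cInf_greatest)
  interpret real_distribution std_normal_distribution
    by (rule real_dist_normal_dist)
  have "\<forall>\<^sub>F x in at_top. q < cdf std_normal_distribution x"
    using cdf_lim_at_top_prob \<open>q < 1\<close> by (rule order_tendstoD)
  then obtain x where "q < cdf std_normal_distribution x"
    by (auto dest!: eventually_happens)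
  then show "{x. q \<le> cdf std_normal_distribution x} \<noteq> {}"
    by (auto intro: less_imp_le)
  show "0 \<le> x" if "x \<in> {x. q \<le> cdf std_normal_distribution x}" for x
    using cdf_std_normal_le_half[of x] that assms by (cases "x < 0") auto
qed

section \<open>Contractions of weighted function spaces\<close>

text \<open>Turns the norm into the product-form pointwise estimate used from here on. Boundedness
  ensures that the real \<open>SUP\<close> is an actual upper bound.\<close>

lemma abs_le_wnorm:
  assumes "bdd_above ((\<lambda>s. \<bar>V s\<bar> / w s) ` S)" "s \<in> S" "0 < w s"
  shows "\<bar>V s\<bar> \<le> wnorm S w V * w s"
proof -
  have "\<bar>V s\<bar> / w s \<le> wnorm S w V"
    unfolding wnorm_def using assms by (intro cSUP_upper)
  then show ?thesis
    using assms(3) by (simp add: pos_divide_le_eq)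
qed

lemma bdd_above_weighted:
  assumes "\<And>s. s \<in> S \<Longrightarrow> \<bar>V s\<bar> \<le> c * w s" "\<And>s. s \<in> S \<Longrightarrow> (0::real) < w s"
  shows "bdd_above ((\<lambda>s. \<bar>V s\<bar> / w s) ` S)"
  using assms by (intro bdd_aboveI2[where M = c]) (simp add: pos_divide_le_eq)

lemma wnorm_le:
  assumes "S \<noteq> {}" "\<And>s. s \<in> S \<Longrightarrow> \<bar>V s\<bar> \<le> c * w s" "\<And>s. s \<in> S \<Longrightarrow> 0 < w s"
  shows "wnorm S w V \<le> c"
  unfolding wnorm_def using assms by (intro cSUP_least) (simp_all add: pos_divide_le_eq)

lemma wnorm_diff_commute: "wnorm S w (\<lambda>s. U s - V s) = wnorm S w (\<lambda>s. V s - U s)"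
  by (simp add: wnorm_def abs_minus_commute)

lemma bdd_above_weighted_diff:
  assumes "U \<in> weighted_space S w" "V \<in> weighted_space S w" and w: "\<And>s. s \<in> S \<Longrightarrow> 0 < w s"
  shows "bdd_above ((\<lambda>s. \<bar>U s - V s\<bar> / w s) ` S)"
proof (rule bdd_above_weighted)
  fix s assume "s \<in> S"
  then have "\<bar>U s\<bar> \<le> wnorm S w U * w s" "\<bar>V s\<bar> \<le> wnorm S w V * w s"
    using assms by (auto simp: weighted_space_def intro!: abs_le_wnorm)
  then show "\<bar>U s - V s\<bar> \<le> (wnorm S w U + wnorm S w V) * w s"
    by (auto simp: distrib_right)
qed (use w in auto)

lemma wnorm_nonneg:
  assumes "S \<noteq> {}" "\<And>s. s \<in> S \<Longrightarrow> 0 < w s" "bdd_above ((\<lambda>s. \<bar>V s\<bar> / w s) ` S)"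
  shows "0 \<le> wnorm S w V"
proof -
  obtain s where "s \<in> S" using \<open>S \<noteq> {}\<close> by auto
  then have "\<bar>V s\<bar> / w s \<le> wnorm S w V"
    unfolding wnorm_def using assms by (intro cSUP_upper)
  moreover have "0 \<le> \<bar>V s\<bar> / w s"
    using assms(2)[OF \<open>s \<in> S\<close>] by simp
  ultimately show ?thesis by linarith
qed

text \<open>The absolute value only matters for unbounded arguments, where the supremum is a junk value.\<close>

definition wdist :: "'s set \<Rightarrow> ('s \<Rightarrow> real) \<Rightarrow> ('s \<Rightarrow> real) \<Rightarrow> ('s \<Rightarrow> real) \<Rightarrow> real" where
  "wdist S w U V = \<bar>wnorm S w (\<lambda>s. U s - V s)\<bar>"

lemma wdist_eq_wnorm:
  assumes "S \<noteq> {}" "\<And>s. s \<in> S \<Longrightarrow> 0 < w s" "U \<in> weighted_space S w" "V \<in> weighted_space S w"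
  shows "wdist S w U V = wnorm S w (\<lambda>s. U s - V s)"
  unfolding wdist_def using assms
  by (intro abs_of_nonneg wnorm_nonneg bdd_above_weighted_diff)

lemma Metric_space_weighted:
  assumes S: "S \<noteq> {}" and w: "\<And>s. s \<in> S \<Longrightarrow> 0 < w s"
  shows "Metric_space (weighted_space S w) (wdist S w)"
proof
  have le: "\<bar>U s - V s\<bar> \<le> wnorm S w (\<lambda>s. U s - V s) * w s"
    if "U \<in> weighted_space S w" "V \<in> weighted_space S w" "s \<in> S" for U V s
    using abs_le_wnorm[OF bdd_above_weighted_diff[OF that(1,2) w] that(3) w] that by simp
  have eq: "wdist S w U V = wnorm S w (\<lambda>s. U s - V s)"
    if "U \<in> weighted_space S w" "V \<in> weighted_space S w" for U V
    using wdist_eq_wnorm[OF S _ that] w by simp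
  \<comment> \<open>Nonnegativity and symmetry are demanded for all arguments, also outside the
    weighted space; this is where the absolute value in \<open>wdist\<close> enters.\<close>
  show "0 \<le> wdist S w U V" for U V
    by (simp add: wdist_def)
  show "wdist S w U V = wdist S w V U" for U V
    by (simp add: wdist_def wnorm_def abs_minus_commute)
  show "wdist S w U V = 0 \<longleftrightarrow> U = V" if UV: "U \<in> weighted_space S w" "V \<in> weighted_space S w" for U V
  proof
    assume "wdist S w U V = 0"
    then have "U s = V s" if "s \<in> S" for s
      using le[OF UV that] eq[OF UV] by auto
    \<comment> \<open>Agreement on \<open>S\<close> gives equality because both functions are
      extensional.\<close>
    then show "U = V"
      using UV by (auto simp: weighted_space_def intro: extensionalityI)
  next
    assume "U = V"
    then show "wdist S w U V = 0"
      using S by (simp add: wdist_def wnorm_def)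
  qed
  show "wdist S w U W \<le> wdist S w U V + wdist S w V W"
    if UVW: "U \<in> weighted_space S w" "V \<in> weighted_space S w" "W \<in> weighted_space S w" for U V W
    unfolding eq[OF UVW(1,2)] eq[OF UVW(1,3)] eq[OF UVW(2,3)]
  proof (rule wnorm_le[OF S _ w])
    fix s assume s: "s \<in> S"
    show "\<bar>U s - W s\<bar> \<le> (wnorm S w (\<lambda>s. U s - V s) + wnorm S w (\<lambda>s. V s - W s)) * w s"
      using le[OF UVW(1,2) s] le[OF UVW(2,3) s] by (auto simp: distrib_right)
  qed
qed

text \<open>A Cauchy sequence in the weighted norm is Cauchy at each state. Letting one index tend
  to infinity in the uniform Cauchy estimate bounds the distance to the pointwise limit, which
  yields both membership of the limit and convergence in norm.\<close>

lemma mcomplete_weighted: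
  assumes S: "S \<noteq> {}" and w: "\<And>s. s \<in> S \<Longrightarrow> 0 < w s"
  shows "Metric_space.mcomplete (weighted_space S w) (wdist S w)"
proof -
  interpret Metric_space "weighted_space S w" "wdist S w"
    using S w by (rule Metric_space_weighted)
  have le: "\<bar>U s - V s\<bar> \<le> wdist S w U V * w s"
    if "U \<in> weighted_space S w" "V \<in> weighted_space S w" "s \<in> S" for U V s
    using abs_le_wnorm[OF bdd_above_weighted_diff[OF that(1,2) w] that(3) w] that
    by (simp add: wdist_eq_wnorm[of S w, OF S w])
  show ?thesis
    unfolding mcomplete_def
  proof (intro allI impI)
    fix \<sigma> assume "MCauchy \<sigma>"
    then have \<sigma>: "\<sigma> n \<in> weighted_space S w" for n
      by (auto simp: MCauchy_def)
    have cauchy: "\<exists>N. \<forall>m\<ge>N. \<forall>n\<ge>N. \<forall>s\<in>S. \<bar>\<sigma> m s - \<sigma> n s\<bar> \<le> e * w s" if "e > 0" for e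
    proof -
      obtain N where N: "\<forall>m n. N \<le> m \<longrightarrow> N \<le> n \<longrightarrow> wdist S w (\<sigma> m) (\<sigma> n) < e"
        using \<open>MCauchy \<sigma>\<close> \<open>e > 0\<close> unfolding MCauchy_def by blast
      have "\<bar>\<sigma> m s - \<sigma> n s\<bar> \<le> e * w s" if "m \<ge> N" "n \<ge> N" "s \<in> S" for m n s
        using le[OF \<sigma>[of m] \<sigma>[of n] \<open>s \<in> S\<close>]
          mult_right_mono[OF less_imp_le[OF N[rule_format, OF that(1,2)]], of "w s"] w[OF \<open>s \<in> S\<close>] by linarith
      then show ?thesis by blast
    qed
    \<comment> \<open>The restriction to \<open>S\<close> keeps the limit extensional, as
      \<open>weighted_space\<close> requires.\<close>
    define L where "L = (\<lambda>s\<in>S. lim (\<lambda>n. \<sigma> n s))"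
    have lim: "(\<lambda>n. \<sigma> n s) \<longlonglongrightarrow> L s" if "s \<in> S" for s
    proof -
      have "Cauchy (\<lambda>n. \<sigma> n s)"
      proof (rule CauchyI)
        fix e :: real assume "e > 0"
        \<comment> \<open>Dividing by \<open>w s\<close> cancels the weight at the fixed state; the
          factor 2 turns the non-strict bound into a strict one.\<close>
        then have "0 < e / (2 * w s)"
          using w[OF that] by simp
        then obtain N where N: "\<forall>m\<ge>N. \<forall>n\<ge>N. \<forall>t\<in>S. \<bar>\<sigma> m t - \<sigma> n t\<bar> \<le> e / (2 * w s) * w t"
          using cauchy by blast
        have "\<bar>\<sigma> m s - \<sigma> n s\<bar> < e" if "m \<ge> N" "n \<ge> N" for m n
        proof -
          have "\<bar>\<sigma> m s - \<sigma> n s\<bar> \<le> e / (2 * w s) * w s"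
            using N \<open>s \<in> S\<close> that by blast
          then show ?thesis
            using w[OF \<open>s \<in> S\<close>] \<open>e > 0\<close> by simp
        qed
        then show "\<exists>N. \<forall>m\<ge>N. \<forall>n\<ge>N. norm (\<sigma> m s - \<sigma> n s) < e"
          by auto
      qed
      then show ?thesis
        using that by (simp add: L_def Cauchy_convergent_iff convergent_LIMSEQ_iff)
    qed
    have unif: "\<exists>N. \<forall>n\<ge>N. \<forall>s\<in>S. \<bar>\<sigma> n s - L s\<bar> \<le> e * w s" if e: "e > 0" for e
    proof -
      obtain N where N: "\<forall>m\<ge>N. \<forall>n\<ge>N. \<forall>s\<in>S. \<bar>\<sigma> m s - \<sigma> n s\<bar> \<le> e * w s"
        using cauchy[OF e] by blast
      have "\<bar>\<sigma> n s - L s\<bar> \<le> e * w s" if "n \<ge> N" "s \<in> S" for n s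
      proof (rule tendsto_upperbound)
        show "(\<lambda>m. \<bar>\<sigma> n s - \<sigma> m s\<bar>) \<longlonglongrightarrow> \<bar>\<sigma> n s - L s\<bar>"
          by (intro tendsto_intros lim that)
        show "\<forall>\<^sub>F m in sequentially. \<bar>\<sigma> n s - \<sigma> m s\<bar> \<le> e * w s"
          using N that by (auto simp: eventually_sequentially)
      qed simp
      then show ?thesis by blast
    qed
    have "L \<in> weighted_space S w"
    proof -
      obtain n where n: "\<forall>s\<in>S. \<bar>\<sigma> n s - L s\<bar> \<le> 1 * w s"
        using unif[of 1] by auto
      have "\<bar>L s\<bar> \<le> (wnorm S w (\<sigma> n) + 1) * w s" if "s \<in> S" for s
      proof -
        have "\<bar>\<sigma> n s\<bar> \<le> wnorm S w (\<sigma> n) * w s"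
          using \<sigma>[of n] that w by (intro abs_le_wnorm) (auto simp: weighted_space_def)
        moreover have "\<bar>\<sigma> n s - L s\<bar> \<le> w s"
          using n that by auto
        ultimately show ?thesis
          unfolding distrib_right by linarith
      qed
      then have "bdd_above ((\<lambda>s. \<bar>L s\<bar> / w s) ` S)"
        using w by (rule bdd_above_weighted)
      then show ?thesis
        by (simp add: weighted_space_def L_def)
    qed
    moreover have "\<exists>N. \<forall>n\<ge>N. wdist S w (\<sigma> n) L < e" if "e > 0" for e
    proof -
      obtain N where N: "\<forall>n\<ge>N. \<forall>s\<in>S. \<bar>\<sigma> n s - L s\<bar> \<le> e / 2 * w s"
        using unif[of "e / 2"] \<open>e > 0\<close> by auto
      have "wdist S w (\<sigma> n) L \<le> e / 2" if "n \<ge> N" for n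
      proof -
        have "wdist S w (\<sigma> n) L = wnorm S w (\<lambda>s. \<sigma> n s - L s)"
          using S w \<sigma> \<open>L \<in> weighted_space S w\<close> by (intro wdist_eq_wnorm)
        also have "\<dots> \<le> e / 2"
          by (rule wnorm_le[OF S]) (use N that w in auto)
        finally show ?thesis .
      qed
      then show ?thesis
        using \<open>e > 0\<close> by (intro exI[of _ N]) fastforce
    qed
    ultimately show "\<exists>L. limitin mtopology \<sigma> L sequentially"
      using \<sigma> by (auto simp: limit_metric_sequentially)
  qed
qed

lemma weighted_contraction_unique_fixed_point:
  assumes S: "S \<noteq> {}" and w: "\<And>s. s \<in> S \<Longrightarrow> 0 < w s"
    and T: "\<And>V. V \<in> weighted_space S w \<Longrightarrow> T V \<in> weighted_space S w"
    and "k < 1"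
    and contr: "\<And>U V. U \<in> weighted_space S w \<Longrightarrow> V \<in> weighted_space S w \<Longrightarrow>
      wnorm S w (\<lambda>s. T U s - T V s) \<le> k * wnorm S w (\<lambda>s. U s - V s)"
  shows "\<exists>!V. V \<in> weighted_space S w \<and> T V = V"
proof -
  interpret Metric_space "weighted_space S w" "wdist S w"
    using S w by (rule Metric_space_weighted)
  have contr': "wdist S w (T U) (T V) \<le> k * wdist S w U V"
    if "U \<in> weighted_space S w" "V \<in> weighted_space S w" for U V
    using contr that T by (simp add: wdist_eq_wnorm[of S w, OF S w])
  \<comment> \<open>Supplies the nonempty carrier for Banach's theorem.\<close>
  have "(\<lambda>s\<in>S. 0) \<in> weighted_space S w"
    using bdd_above_weighted[of S "\<lambda>s\<in>S. 0" 0 w] w by (auto simp: weighted_space_def)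
  then obtain V where V: "V \<in> weighted_space S w" "T V = V"
    using Banach_fixedpoint_thm[OF mcomplete_weighted, of T k] S w T \<open>k < 1\<close> contr' by blast
  moreover have "U = V" if "U \<in> weighted_space S w" "T U = U" for U
    using contraction_imp_unique_fixpoint[of T U V k] that V T \<open>k < 1\<close> contr' by blast
  ultimately show ?thesis by blast
qed

section \<open>Robust Bellman operators\<close>

text \<open>Nonnegative weights give monotonicity, and total mass 1 lets the constant pass through
  unchanged.\<close>

lemma expect_mono_add:
  assumes "P \<in> prob_vectors" "\<And>j. f (\<xi> j) \<le> f' (\<xi> j) + c"
  shows "expect \<xi> P f \<le> expect \<xi> P f' + c"
proof -
  have "expect \<xi> P f \<le> (\<Sum>j\<in>UNIV. P $ j * (f' (\<xi> j) + c))"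
    unfolding expect_def using assms by (intro sum_mono mult_left_mono) (auto simp: prob_vectors_def)
  also have "\<dots> = expect \<xi> P f' + (\<Sum>j\<in>UNIV. P $ j) * c"
    by (simp add: expect_def distrib_left sum.distrib sum_distrib_right)
  finally show ?thesis
    using assms by (simp add: prob_vectors_def)
qed

lemma abs_expect_le:
  assumes "P \<in> prob_vectors" "\<And>j. \<bar>f (\<xi> j)\<bar> \<le> c"
  shows "\<bar>expect \<xi> P f\<bar> \<le> c"
proof -
  have "f (\<xi> j) \<le> 0 + c" "0 \<le> f (\<xi> j) + c" for j
    using assms(2)[of j] by auto
  then show ?thesis
    using expect_mono_add[OF assms(1), of f \<xi> "\<lambda>_. 0" c] expect_mono_add[OF assms(1), of "\<lambda>_. 0" \<xi> f c]
    by (simp add: expect_def abs_le_iff)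
qed

text \<open>The pairing of an l1-norm with a supremum norm; it controls the effect of changing the
  distribution while the integrand stays fixed.\<close>

lemma abs_expect_diff_le:
  assumes "\<And>j. \<bar>f (\<xi> j)\<bar> \<le> c"
  shows "\<bar>expect \<xi> P f - expect \<xi> P' f\<bar> \<le> (\<Sum>j\<in>UNIV. \<bar>P $ j - P' $ j\<bar>) * c"
proof -
  have "\<bar>expect \<xi> P f - expect \<xi> P' f\<bar> = \<bar>\<Sum>j\<in>UNIV. (P $ j - P' $ j) * f (\<xi> j)\<bar>"
    by (simp add: expect_def sum_subtractf left_diff_distrib)
  also have "\<dots> \<le> (\<Sum>j\<in>UNIV. \<bar>(P $ j - P' $ j) * f (\<xi> j)\<bar>)"
    by (rule sum_abs)
  also have "\<dots> \<le> (\<Sum>j\<in>UNIV. \<bar>P $ j - P' $ j\<bar> * c)"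
    using assms by (intro sum_mono) (auto simp: abs_mult intro: mult_left_mono)
  finally show ?thesis
    by (simp add: sum_distrib_right)
qed

text \<open>The common comparison principle. Each \<open>p\<close> is matched with some
  \<open>p'\<close>, possibly depending on \<open>a\<close>, which covers both equal ambiguity sets
  (match \<open>p\<close> with itself) and a comparison with a singleton. The bounds
  \<open>b\<close> and \<open>b'\<close> make the real-valued extrema meaningful.\<close>

lemma INF_SUP_le_add:
  fixes f f' :: "'a \<Rightarrow> 'p \<Rightarrow> real"
  assumes "A \<noteq> {}" "Q \<noteq> {}"
    and f: "\<And>a p. a \<in> A \<Longrightarrow> p \<in> Q \<Longrightarrow> \<bar>f a p\<bar> \<le> b"
    and f': "\<And>a p. a \<in> A \<Longrightarrow> p \<in> Q' \<Longrightarrow> \<bar>f' a p\<bar> \<le> b'"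
    and le: "\<And>a p. a \<in> A \<Longrightarrow> p \<in> Q \<Longrightarrow> \<exists>p'\<in>Q'. f a p \<le> f' a p' + e"
  shows "(INF a\<in>A. SUP p\<in>Q. f a p) \<le> (INF a\<in>A. SUP p\<in>Q'. f' a p) + e"
proof -
  have bdd: "bdd_above (f a ` Q)" "bdd_above (f' a ` Q')" if "a \<in> A" for a
    using f[OF that] f'[OF that] by (auto intro!: bdd_aboveI2 simp: abs_le_iff)
  have "bdd_below ((\<lambda>a. SUP p\<in>Q. f a p) ` A)"
  proof (rule bdd_belowI2)
    fix a assume "a \<in> A"
    obtain p where "p \<in> Q" using \<open>Q \<noteq> {}\<close> by auto
    have "- b \<le> f a p"
      using f[OF \<open>a \<in> A\<close> \<open>p \<in> Q\<close>] by linarith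
    also have "\<dots> \<le> (SUP p\<in>Q. f a p)"
      using \<open>p \<in> Q\<close> bdd[OF \<open>a \<in> A\<close>] by (intro cSUP_upper)
    finally show "- b \<le> (SUP p\<in>Q. f a p)" .
  qed
  have "(INF a\<in>A. SUP p\<in>Q. f a p) - e \<le> (INF a\<in>A. SUP p\<in>Q'. f' a p)"
  proof (rule cINF_greatest[OF \<open>A \<noteq> {}\<close>])
    fix a assume a: "a \<in> A"
    have "(INF a\<in>A. SUP p\<in>Q. f a p) \<le> (SUP p\<in>Q. f a p)"
      using a \<open>bdd_below _\<close> by (intro cINF_lower)
    also have "\<dots> \<le> (SUP p\<in>Q'. f' a p) + e"
    proof (rule cSUP_least[OF \<open>Q \<noteq> {}\<close>])
      fix p assume "p \<in> Q"
      then obtain p' where "p' \<in> Q'" "f a p \<le> f' a p' + e"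
        using le[OF a] by blast
      moreover have "f' a p' \<le> (SUP p\<in>Q'. f' a p)"
        using \<open>p' \<in> Q'\<close> bdd[OF a] by (intro cSUP_upper)
      ultimately show "f a p \<le> (SUP p\<in>Q'. f' a p) + e"
        by linarith
    qed
    finally show "(INF a\<in>A. SUP p\<in>Q. f a p) - e \<le> (SUP p\<in>Q'. f' a p)"
      by simp
  qed
  then show ?thesis by simp
qed

text \<open>Lets the true operator share the theory of the robust ones.\<close>

lemma bellman_eq_robust: "bellman S A \<xi> C g \<gamma> P = robust_bellman S A \<xi> C g \<gamma> {P}"
  by (simp add: fun_eq_iff bellman_def robust_bellman_def)

section \<open>Contraction property in the weighted norm\<close>

locale weighted_mdp =
  fixes S :: "'s set" and A :: "'a set" and \<xi> :: "'j::finite \<Rightarrow> 'x"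
    and C :: "'s \<Rightarrow> 'a \<Rightarrow> 'x \<Rightarrow> real" and g :: "'s \<Rightarrow> 'a \<Rightarrow> 'x \<Rightarrow> 's"
    and w :: "'s \<Rightarrow> real" and \<gamma> Cw \<kappa> :: real
  assumes S: "S \<noteq> {}" and A: "A \<noteq> {}"
    and g: "\<And>s a j. s \<in> S \<Longrightarrow> a \<in> A \<Longrightarrow> g s a (\<xi> j) \<in> S"
    and w: "\<And>s. s \<in> S \<Longrightarrow> 0 < w s"
    and C_le: "\<And>s a j. s \<in> S \<Longrightarrow> a \<in> A \<Longrightarrow> \<bar>C s a (\<xi> j)\<bar> \<le> Cw * w s"
    and w_g_le: "\<And>s a j. s \<in> S \<Longrightarrow> a \<in> A \<Longrightarrow> w (g s a (\<xi> j)) \<le> \<kappa> * w s"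
    and \<gamma>: "0 \<le> \<gamma>" and contraction: "\<gamma> * \<kappa> < 1"
begin

abbreviation "RB \<equiv> robust_bellman S A \<xi> C g \<gamma>"

abbreviation "Q_value s V a P \<equiv> expect \<xi> P (\<lambda>x. C s a x + \<gamma> * V (g s a x))"

lemma weighted_space_abs_le:
  assumes "V \<in> weighted_space S w" "s \<in> S"
  shows "\<bar>V s\<bar> \<le> wnorm S w V * w s"
  using assms w by (auto simp: weighted_space_def intro!: abs_le_wnorm)

text \<open>The source of the modulus \<open>\<gamma> * \<kappa>\<close>: discounting contributes
  \<gamma>, and one transition enlarges the weight by at most \<kappa>. Being one-sided, the bound
  applies to absolute values as well as to signed differences of value functions.\<close>

lemma scaled_next_le:
  assumes "s \<in> S" "a \<in> A" "0 \<le> v" and V: "\<And>s. s \<in> S \<Longrightarrow> V s \<le> v * w s"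
  shows "\<gamma> * V (g s a (\<xi> j)) \<le> \<gamma> * \<kappa> * v * w s"
proof -
  have "V (g s a (\<xi> j)) \<le> v * w (g s a (\<xi> j))"
    using V g assms by blast
  also have "\<dots> \<le> v * (\<kappa> * w s)"
    using assms by (intro mult_left_mono w_g_le)
  finally show ?thesis
    using mult_left_mono[OF _ \<gamma>] by (fastforce simp: mult_ac)
qed

lemma integrand_abs_le:
  assumes "V \<in> weighted_space S w" "s \<in> S" "a \<in> A"
  shows "\<bar>C s a (\<xi> j) + \<gamma> * V (g s a (\<xi> j))\<bar> \<le> (Cw + \<gamma> * \<kappa> * wnorm S w V) * w s"
proof -
  have nonneg: "0 \<le> wnorm S w V"
    using assms S w by (intro wnorm_nonneg) (auto simp: weighted_space_def)
  have "\<gamma> * \<bar>V (g s a (\<xi> j))\<bar> \<le> \<gamma> * \<kappa> * wnorm S w V * w s"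
    using scaled_next_le[of s a "wnorm S w V" "\<lambda>s. \<bar>V s\<bar>"] assms nonneg weighted_space_abs_le by blast
  then have "\<bar>\<gamma> * V (g s a (\<xi> j))\<bar> \<le> \<gamma> * \<kappa> * wnorm S w V * w s"
    using \<gamma> by (simp add: abs_mult)
  then show ?thesis
    using C_le[OF assms(2,3), of j] unfolding distrib_right by linarith
qed

lemma Q_value_abs_le:
  assumes "V \<in> weighted_space S w" "s \<in> S" "a \<in> A" "P \<in> prob_vectors"
  shows "\<bar>Q_value s V a P\<bar> \<le> (Cw + \<gamma> * \<kappa> * wnorm S w V) * w s"
  using assms by (intro abs_expect_le integrand_abs_le)

lemma RB_le_add:
  assumes "Q \<noteq> {}" "Q \<subseteq> prob_vectors" "Q' \<subseteq> prob_vectors"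
    and "U \<in> weighted_space S w" "V \<in> weighted_space S w" "s \<in> S"
    and "\<And>a P. a \<in> A \<Longrightarrow> P \<in> Q \<Longrightarrow> \<exists>P'\<in>Q'. Q_value s U a P \<le> Q_value s V a P' + e"
  shows "RB Q U s \<le> RB Q' V s + e"
  unfolding robust_bellman_def restrict_apply' [OF \<open>s \<in> S\<close>]
  using assms by (intro INF_SUP_le_add[OF A \<open>Q \<noteq> {}\<close> Q_value_abs_le Q_value_abs_le]) auto

lemma RB_in_weighted_space:
  assumes "Q \<noteq> {}" "Q \<subseteq> prob_vectors" "V \<in> weighted_space S w"
  shows "RB Q V \<in> weighted_space S w"
proof -
  let ?b = "\<lambda>s. (Cw + \<gamma> * \<kappa> * wnorm S w V) * w s"
  have "\<bar>RB Q V s\<bar> \<le> ?b s" if s: "s \<in> S" for s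
  proof -
    have bound: "\<bar>Q_value s V a P\<bar> \<le> ?b s" if "a \<in> A" "P \<in> Q" for a P
      using Q_value_abs_le assms s that by blast
    \<comment> \<open>Both sides of the bound come from a comparison with the zero payoff, whose
      inf-sup value is 0.\<close>
    have "(INF a\<in>A. SUP P\<in>Q. Q_value s V a P) \<le> (INF a\<in>A. SUP P\<in>Q. 0) + ?b s"
      using bound by (intro INF_SUP_le_add[OF A \<open>Q \<noteq> {}\<close>, where b' = 0]) (auto simp: abs_le_iff)
    moreover have "(INF a\<in>A. SUP P\<in>Q. 0) \<le> (INF a\<in>A. SUP P\<in>Q. Q_value s V a P) + ?b s"
    proof (rule INF_SUP_le_add[OF A \<open>Q \<noteq> {}\<close>, where b = 0])
      fix a P assume "a \<in> A" "P \<in> Q"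
      then show "\<exists>P'\<in>Q. 0 \<le> Q_value s V a P' + ?b s"
        using bound[of a P] by (intro bexI[of _ P]) linarith+
    qed (use bound in auto)
    ultimately show ?thesis
      using A \<open>Q \<noteq> {}\<close> s by (simp add: robust_bellman_def abs_le_iff)
  qed
  then have "bdd_above ((\<lambda>s. \<bar>RB Q V s\<bar> / w s) ` S)"
    using w by (rule bdd_above_weighted)
  then show ?thesis
    by (simp add: weighted_space_def robust_bellman_def)
qed

lemma Q_value_le_add:
  assumes "U \<in> weighted_space S w" "V \<in> weighted_space S w" "s \<in> S" "a \<in> A" "P \<in> prob_vectors"
  shows "Q_value s U a P \<le> Q_value s V a P + \<gamma> * \<kappa> * wnorm S w (\<lambda>s. U s - V s) * w s"
proof (rule expect_mono_add)
  let ?D = "wnorm S w (\<lambda>s. U s - V s)"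
  have bdd: "bdd_above ((\<lambda>s. \<bar>U s - V s\<bar> / w s) ` S)"
    using assms w by (intro bdd_above_weighted_diff)
  have "U s - V s \<le> ?D * w s" if "s \<in> S" for s
    using abs_le_wnorm[OF bdd that w[OF that]] by linarith
  moreover have "0 \<le> ?D"
    using S w bdd by (rule wnorm_nonneg)
  ultimately have "\<gamma> * (U (g s a (\<xi> j)) - V (g s a (\<xi> j))) \<le> \<gamma> * \<kappa> * ?D * w s" for j
    using scaled_next_le[of s a ?D "\<lambda>s. U s - V s"] assms by blast
  then show "C s a (\<xi> j) + \<gamma> * U (g s a (\<xi> j))
      \<le> C s a (\<xi> j) + \<gamma> * V (g s a (\<xi> j)) + \<gamma> * \<kappa> * ?D * w s" for j
    by (simp add: right_diff_distrib algebra_simps)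
qed fact

text \<open>Each distribution is matched with itself, so only the value functions differ; exchanging
  \<open>U\<close> and \<open>V\<close> gives the reverse inequality.\<close>

lemma RB_contraction:
  assumes "Q \<noteq> {}" "Q \<subseteq> prob_vectors" "U \<in> weighted_space S w" "V \<in> weighted_space S w"
  shows "wnorm S w (\<lambda>s. RB Q U s - RB Q V s) \<le> \<gamma> * \<kappa> * wnorm S w (\<lambda>s. U s - V s)"
proof (rule wnorm_le[OF S _ w])
  fix s assume s: "s \<in> S"
  let ?e = "\<gamma> * \<kappa> * wnorm S w (\<lambda>s. U s - V s) * w s"
  have "RB Q U s \<le> RB Q V s + ?e"
    by (rule RB_le_add) (use assms s Q_value_le_add[of U V] in blast)+
  moreover have "RB Q V s \<le> RB Q U s + ?e"
    unfolding wnorm_diff_commute[of S w U]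
    by (rule RB_le_add) (use assms s Q_value_le_add[of V U] in blast)+
  ultimately show "\<bar>RB Q U s - RB Q V s\<bar> \<le> ?e"
    by linarith
qed

lemma RB_unique_fixed_point:
  assumes "Q \<noteq> {}" "Q \<subseteq> prob_vectors"
  shows "\<exists>!V. V \<in> weighted_space S w \<and> RB Q V = V"
  using RB_in_weighted_space[OF assms] RB_contraction[OF assms]
  by (intro weighted_contraction_unique_fixed_point[of S w, OF S w _ contraction])

lemma RB_fixed_point:
  assumes "Q \<noteq> {}" "Q \<subseteq> prob_vectors"
  shows "fixed_point S w (RB Q) \<in> weighted_space S w"
    and "RB Q (fixed_point S w (RB Q)) = fixed_point S w (RB Q)"
  using theI'[OF RB_unique_fixed_point[OF assms]] by (auto simp: fixed_point_def)

section \<open>Stability of the fixed point under changes of the ambiguity set\<close>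

text \<open>Passing from \<open>U\<close> to \<open>V\<close> under one distribution costs
  \<open>\<gamma> * \<kappa>\<close> times their distance; passing from that distribution to
  \<open>P0\<close> at the fixed function \<open>V\<close> costs \<delta> times the bound on the
  integrand. The distance thus satisfies an implicit inequality that can be solved for it.\<close>

lemma wnorm_fixed_point_diff_le:
  assumes Q: "Q \<noteq> {}" "Q \<subseteq> prob_vectors" and P0: "P0 \<in> prob_vectors"
    and \<delta>: "\<And>P. P \<in> Q \<Longrightarrow> (\<Sum>j\<in>UNIV. \<bar>P $ j - P0 $ j\<bar>) \<le> \<delta>"
  defines "U \<equiv> fixed_point S w (RB Q)" and "V \<equiv> fixed_point S w (RB {P0})"
  shows "wnorm S w (\<lambda>s. U s - V s) \<le> \<delta> * (Cw + \<gamma> * \<kappa> * wnorm S w V) / (1 - \<gamma> * \<kappa>)"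
proof -
  have U: "U \<in> weighted_space S w" "RB Q U = U"
    unfolding U_def by (rule RB_fixed_point[OF Q])+
  have V: "V \<in> weighted_space S w" "RB {P0} V = V"
    unfolding V_def using P0 by (auto intro!: RB_fixed_point)
  let ?D = "wnorm S w (\<lambda>s. U s - V s)" and ?K = "Cw + \<gamma> * \<kappa> * wnorm S w V"
  have "?D \<le> \<gamma> * \<kappa> * ?D + \<delta> * ?K"
  proof (rule wnorm_le[OF S _ w])
    fix s assume s: "s \<in> S"
    let ?e = "(\<gamma> * \<kappa> * ?D + \<delta> * ?K) * w s"
    \<comment> \<open>Nonnegative because it dominates an absolute value, at any available action;
      this allows \<delta> to replace the l1-distance in the product.\<close>
    have K: "0 \<le> ?K * w s"
      using abs_ge_zero Q_value_abs_le[OF V(1) s _ P0] A by (meson all_not_in_conv order_trans)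
    have near: "\<bar>Q_value s V a P - Q_value s V a P0\<bar> \<le> \<delta> * ?K * w s" if "a \<in> A" "P \<in> Q" for a P
    proof -
      have "\<bar>Q_value s V a P - Q_value s V a P0\<bar> \<le> (\<Sum>j\<in>UNIV. \<bar>P $ j - P0 $ j\<bar>) * (?K * w s)"
        using V s that by (intro abs_expect_diff_le integrand_abs_le)
      also have "\<dots> \<le> \<delta> * (?K * w s)"
        using K \<delta>[OF \<open>P \<in> Q\<close>] by (rule mult_right_mono[rotated])
      finally show ?thesis by (simp add: mult_ac)
    qed
    have "RB Q U s \<le> RB {P0} V s + ?e"
    proof (rule RB_le_add)
      fix a P assume a: "a \<in> A" and P: "P \<in> Q"
      have "Q_value s U a P \<le> Q_value s V a P + \<gamma> * \<kappa> * ?D * w s"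
        using U V s a P Q by (intro Q_value_le_add) auto
      then have "Q_value s U a P \<le> Q_value s V a P0 + ?e"
        using near[OF a P] unfolding distrib_right by linarith
      then show "\<exists>P'\<in>{P0}. Q_value s U a P \<le> Q_value s V a P' + ?e"
        by blast
    qed (use Q P0 U V s in auto)
    moreover have "RB {P0} V s \<le> RB Q U s + ?e"
    proof (rule RB_le_add)
      fix a P assume a: "a \<in> A" and P: "P \<in> {P0}"
      \<comment> \<open>Any member of \<open>Q\<close> will do, since all of them lie within
        \<delta> of \<open>P0\<close>.\<close>
      obtain P' where P': "P' \<in> Q" using Q by auto
      have "Q_value s V a P' \<le> Q_value s U a P' + \<gamma> * \<kappa> * wnorm S w (\<lambda>s. V s - U s) * w s"
        using U V s a P' Q by (intro Q_value_le_add) auto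
      then have "Q_value s V a P0 \<le> Q_value s U a P' + ?e"
        using near[OF a P'] unfolding distrib_right wnorm_diff_commute[of S w V] by linarith
      then show "\<exists>P'\<in>Q. Q_value s V a P \<le> Q_value s U a P' + ?e"
        using P P' by blast
    qed (use Q P0 U V s in auto)
    ultimately show "\<bar>U s - V s\<bar> \<le> ?e"
      unfolding U V by linarith
  qed
  \<comment> \<open>The term with factor \<open>\<gamma> * \<kappa>\<close> is absorbed on the left,
    leaving the positive factor \<open>1 - \<gamma> * \<kappa>\<close>.\<close>
  then show ?thesis
    using contraction by (simp add: pos_le_divide_eq algebra_simps)
qed

text \<open>The constant in the stability bound involves only the fixed point for \<open>P0\<close>,
  so it is the same for every \<open>N\<close> and the bound vanishes with \<delta>.\<close>

lemma wnorm_fixed_point_diff_tendsto_0: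
  fixes Q :: "nat \<Rightarrow> (real ^ 'j) set"
  assumes Q: "\<And>N. Q N \<noteq> {}" "\<And>N. Q N \<subseteq> prob_vectors" and P0: "P0 \<in> prob_vectors"
    and \<delta>: "\<And>N P. P \<in> Q N \<Longrightarrow> (\<Sum>j\<in>UNIV. \<bar>P $ j - P0 $ j\<bar>) \<le> \<delta> N" "\<delta> \<longlonglongrightarrow> 0"
  shows "(\<lambda>N. wnorm S w (\<lambda>s. fixed_point S w (RB (Q N)) s - fixed_point S w (RB {P0}) s)) \<longlonglongrightarrow> 0"
proof (rule tendsto_sandwich)
  let ?V = "fixed_point S w (RB {P0})"
  let ?K = "Cw + \<gamma> * \<kappa> * wnorm S w ?V"
  have V: "?V \<in> weighted_space S w"
    using P0 by (auto intro!: RB_fixed_point)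
  show "\<forall>\<^sub>F N in sequentially. 0 \<le> wnorm S w (\<lambda>s. fixed_point S w (RB (Q N)) s - ?V s)"
    using w V by (intro always_eventually allI wnorm_nonneg[OF S] bdd_above_weighted_diff
        RB_fixed_point(1)[OF Q])
  show "\<forall>\<^sub>F N in sequentially. wnorm S w (\<lambda>s. fixed_point S w (RB (Q N)) s - ?V s)
      \<le> \<delta> N * ?K / (1 - \<gamma> * \<kappa>)"
    by (intro always_eventually allI wnorm_fixed_point_diff_le Q P0 \<delta>)
  have "(\<lambda>N. \<delta> N * ?K / (1 - \<gamma> * \<kappa>)) \<longlonglongrightarrow> 0 * ?K / (1 - \<gamma> * \<kappa>)"
    using contraction by (intro tendsto_intros \<delta>) auto
  then show "(\<lambda>N. \<delta> N * ?K / (1 - \<gamma> * \<kappa>)) \<longlonglongrightarrow> 0"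
    by simp
qed simp

end

section \<open>Bayesian ambiguity sets\<close>

lemma post_param_gt_1:
  assumes "1 < \<tau>0 j"
  shows "1 < post_param \<xi> \<tau>0 X N \<omega> j"
  unfolding post_param_def by (rule less_le_trans[OF assms]) (simp add: sum_nonneg)

text \<open>The denominator is the sum of the numerators, because J is a sum of J ones; the
  numerators are positive since every prior parameter exceeds 1.\<close>

lemma p_hat_in_prob_vectors:
  fixes \<xi> :: "'j::finite \<Rightarrow> 'x"
  assumes "\<And>j. 1 < \<tau>0 j"
  shows "p_hat \<xi> \<tau>0 X N \<omega> \<in> prob_vectors"
proof -
  let ?t = "\<lambda>j. post_param \<xi> \<tau>0 X N \<omega> j - 1"
  have pos: "0 < ?t j" for j
    using post_param_gt_1[of \<tau>0 j] assms by simp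
  have denom: "(\<Sum>k\<in>UNIV. post_param \<xi> \<tau>0 X N \<omega> k) - real CARD('j) = (\<Sum>k\<in>UNIV. ?t k)"
    by (simp add: sum_subtractf)
  have "0 < (\<Sum>k\<in>UNIV. ?t k)"
    using pos by (intro sum_pos) auto
  moreover have "?t j \<le> (\<Sum>k\<in>UNIV. ?t k)" for j
    using pos by (intro member_le_sum) (auto intro: less_imp_le)
  ultimately show ?thesis
    using pos by (simp add: prob_vectors_def p_hat_def denom divide_le_eq
        sum_divide_distrib[symmetric] less_imp_le)
qed

lemma r_hat_nonneg:
  fixes \<xi> :: "'j::finite \<Rightarrow> 'x"
  assumes "\<And>j. 1 < \<tau>0 j" "0 < \<alpha>" "\<alpha> < 1"
  shows "0 \<le> r_hat \<alpha> \<xi> \<tau>0 X N \<omega> $ j"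
proof -
  \<comment> \<open>This places the quantile level strictly between 1/2 and 1.\<close>
  have "0 < \<alpha> / real CARD('j)" "\<alpha> / real CARD('j) < 1"
    using assms by (auto simp: divide_less_eq intro: less_le_trans[of _ 1])
  then have "0 \<le> std_normal_quantile (1 - \<alpha> / real CARD('j) / 2)"
    by (intro std_normal_quantile_nonneg) auto
  moreover have "real CARD('j) \<le> (\<Sum>k\<in>UNIV. post_param \<xi> \<tau>0 X N \<omega> k)"
    using sum_bounded_below[of UNIV 1 "post_param \<xi> \<tau>0 X N \<omega>"]
      less_imp_le[OF post_param_gt_1[of \<tau>0 _ \<xi> X N \<omega>, OF assms(1)]] by simp
  moreover have "0 \<le> p_hat \<xi> \<tau>0 X N \<omega> $ j" "p_hat \<xi> \<tau>0 X N \<omega> $ j \<le> 1"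
    using p_hat_in_prob_vectors[of \<tau>0 \<xi> X N \<omega>] assms(1) by (auto simp: prob_vectors_def)
  ultimately show ?thesis
    by (simp add: r_hat_def)
qed

lemma ambiguity_set_subset: "ambiguity_set P r \<subseteq> prob_vectors"
  by (auto simp: ambiguity_set_def)

text \<open>The centre is a member because the radii are nonnegative. Without a member the inner
  \<open>SUP\<close> would be an uninformative value.\<close>

lemma bayes_ambiguity_set_nonempty:
  assumes "\<And>j. 1 < \<tau>0 j" "0 < \<alpha>" "\<alpha> < 1"
  shows "ambiguity_set (p_hat \<xi> \<tau>0 X N \<omega>) (r_hat \<alpha> \<xi> \<tau>0 X N \<omega>) \<noteq> {}"
proof -
  have "p_hat \<xi> \<tau>0 X N \<omega> \<in> ambiguity_set (p_hat \<xi> \<tau>0 X N \<omega>) (r_hat \<alpha> \<xi> \<tau>0 X N \<omega>)"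
    using p_hat_in_prob_vectors[of \<tau>0 \<xi> X N \<omega>] r_hat_nonneg[of \<tau>0 \<alpha> \<xi> X N \<omega>] assms
    by (simp add: ambiguity_set_def)
  then show ?thesis by blast
qed

section \<open>Consistency of the estimators along a sample path\<close>

text \<open>Each observation raises exactly one count: at least one because it lies in the support,
  at most one because \<open>\<xi>\<close> is injective.\<close>

lemma sum_post_param:
  fixes \<xi> :: "'j::finite \<Rightarrow> 'x"
  assumes "inj \<xi>" "\<And>i. i \<ge> 1 \<Longrightarrow> X i \<omega> \<in> range \<xi>"
  shows "(\<Sum>j\<in>UNIV. post_param \<xi> \<tau>0 X N \<omega> j) = (\<Sum>j\<in>UNIV. \<tau>0 j) + real N"
proof -
  have "(\<Sum>j\<in>UNIV. if X i \<omega> = \<xi> j then 1 else (0::real)) = 1" if "i \<in> {1..N}" for i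
  proof -
    obtain k where "X i \<omega> = \<xi> k"
      using assms(2)[of i] \<open>i \<in> {1..N}\<close> by auto
    then show ?thesis
      using \<open>inj \<xi>\<close> by (simp add: inj_eq)
  qed
  then have "(\<Sum>i=1..N. \<Sum>j\<in>UNIV. if X i \<omega> = \<xi> j then 1 else (0::real)) = real N"
    by simp
  then show ?thesis
    unfolding post_param_def sum.distrib sum.swap[of _ "{1..N}" UNIV] by simp
qed

text \<open>After division of numerator and denominator by \<open>N\<close>, the prior enters only
  through constants over \<open>N\<close>, which vanish, and the empirical frequency remains. The
  rewriting needs \<open>N > 0\<close>, hence holds only eventually.\<close>

lemma p_hat_tendsto:
  fixes \<xi> :: "'j::finite \<Rightarrow> 'x"
  assumes "inj \<xi>" "\<And>i. i \<ge> 1 \<Longrightarrow> X i \<omega> \<in> range \<xi>"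
    and freq: "(\<lambda>N. (\<Sum>i=1..N. if X i \<omega> = \<xi> j then 1 else (0::real)) / real N) \<longlonglongrightarrow> p"
  shows "(\<lambda>N. p_hat \<xi> \<tau>0 X N \<omega> $ j) \<longlonglongrightarrow> p"
proof (rule Lim_transform_eventually)
  define c where "c = (\<Sum>j\<in>UNIV. \<tau>0 j) - real CARD('j)"
  let ?F = "\<lambda>N. (\<Sum>i=1..N. if X i \<omega> = \<xi> j then 1 else (0::real))"
  have "(\<lambda>N. ((\<tau>0 j - 1) / real N + ?F N / real N) / (1 + c / real N)) \<longlonglongrightarrow> (0 + p) / (1 + 0)"
    by (intro tendsto_intros freq lim_const_over_n) auto
  then show "(\<lambda>N. ((\<tau>0 j - 1) / real N + ?F N / real N) / (1 + c / real N)) \<longlonglongrightarrow> p"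
    by simp
  show "\<forall>\<^sub>F N in sequentially.
      ((\<tau>0 j - 1) / real N + ?F N / real N) / (1 + c / real N) = p_hat \<xi> \<tau>0 X N \<omega> $ j"
    using eventually_gt_at_top[of 0]
  proof eventually_elim
    case (elim N)
    have "(\<Sum>j\<in>UNIV. post_param \<xi> \<tau>0 X N \<omega> j) - real CARD('j) = real N + c"
      using assms by (simp add: sum_post_param c_def)
    then have "p_hat \<xi> \<tau>0 X N \<omega> $ j = (\<tau>0 j - 1 + ?F N) / (real N + c)"
      by (simp add: p_hat_def post_param_def)
    also have "\<dots> = ((\<tau>0 j - 1 + ?F N) / real N) / ((real N + c) / real N)"
      using elim by (subst divide_divide_eq_right) simp
    also have "\<dots> = ((\<tau>0 j - 1) / real N + ?F N / real N) / (1 + c / real N)"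
      using elim by (simp add: add_divide_distrib)
    finally show ?case by simp
  qed
qed

text \<open>Under the root a convergent factor is divided by a total growing like \<open>N\<close>;
  the quantile is a constant factor.\<close>

lemma r_hat_tendsto_0:
  fixes \<xi> :: "'j::finite \<Rightarrow> 'x"
  assumes "inj \<xi>" "\<And>i. i \<ge> 1 \<Longrightarrow> X i \<omega> \<in> range \<xi>"
    and p: "(\<lambda>N. p_hat \<xi> \<tau>0 X N \<omega> $ j) \<longlonglongrightarrow> p"
  shows "(\<lambda>N. r_hat \<alpha> \<xi> \<tau>0 X N \<omega> $ j) \<longlonglongrightarrow> 0"
proof -
  define c where "c = (\<Sum>j\<in>UNIV. \<tau>0 j) - real CARD('j)"
  let ?z = "std_normal_quantile (1 - \<alpha> / real CARD('j) / 2)" and ?p = "\<lambda>N. p_hat \<xi> \<tau>0 X N \<omega> $ j"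
  have "filterlim (\<lambda>N. c + real N) at_top sequentially"
    by (intro filterlim_tendsto_add_at_top[OF tendsto_const] filterlim_real_sequentially)
  then have "(\<lambda>N. ?z * sqrt (?p N * (1 - ?p N) * inverse (c + real N)))
      \<longlonglongrightarrow> ?z * sqrt (p * (1 - p) * 0)"
    by (intro tendsto_intros p tendsto_inverse_0_at_top)
  moreover have "r_hat \<alpha> \<xi> \<tau>0 X N \<omega> $ j = ?z * sqrt (?p N * (1 - ?p N) * inverse (c + real N))" for N
  proof -
    have "(\<Sum>j\<in>UNIV. post_param \<xi> \<tau>0 X N \<omega> j) - real CARD('j) = c + real N"
      using assms by (simp add: sum_post_param c_def)
    then show ?thesis
      by (simp only: r_hat_def vec_lambda_beta divide_inverse)
  qed
  ultimately show ?thesis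
    by simp
qed

text \<open>For fixed \<open>j\<close> the hit indicators are independent, take values in [0, 1] and
  have mean \<open>P $ j\<close>, so the strong law applies; the finitely many null sets are then
  combined.\<close>

lemma (in prob_space) AE_empirical_frequency_tendsto:
  fixes \<xi> :: "'j::finite \<Rightarrow> 'x"
  assumes indep: "indep_vars (\<lambda>_. count_space (range \<xi>)) X {1::nat..}"
    and prob: "\<And>i j. i \<ge> 1 \<Longrightarrow> prob {\<omega> \<in> space M. X i \<omega> = \<xi> j} = P $ j"
  shows "AE \<omega> in M. \<forall>j. (\<lambda>N. (\<Sum>i=1..N. if X i \<omega> = \<xi> j then 1 else (0::real)) / real N) \<longlonglongrightarrow> P $ j"
proof (subst AE_all_countable, rule allI)
  fix j
  let ?Y = "\<lambda>i \<omega>. if X i \<omega> = \<xi> j then 1 else (0::real)"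
  have "indep_vars (\<lambda>_. borel) ?Y {1..}"
    by (rule indep_vars_compose2[OF indep]) auto
  moreover have "expectation (?Y i) = P $ j" if "i \<ge> 1" for i
  proof -
    have [measurable]: "X i \<in> M \<rightarrow>\<^sub>M count_space (range \<xi>)"
      using indep that by (auto simp: indep_vars_def)
    have "{\<omega> \<in> space M. X i \<omega> = \<xi> j} = X i -` {\<xi> j} \<inter> space M"
      by auto
    also have "\<dots> \<in> events"
      by (rule measurable_sets[of _ _ "count_space (range \<xi>)"]) auto
    finally have "expectation (indicator {\<omega> \<in> space M. X i \<omega> = \<xi> j}) = P $ j"
      using prob[OF that] by simp
    also have "expectation (indicator {\<omega> \<in> space M. X i \<omega> = \<xi> j}) = expectation (?Y i)"
      by (intro Bochner_Integration.integral_cong) (auto simp: indicator_def)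
    finally show ?thesis .
  qed
  ultimately show "AE \<omega> in M. (\<lambda>N. (\<Sum>i=1..N. ?Y i \<omega>) / real N) \<longlonglongrightarrow> P $ j"
    by (intro strong_law_bounded[where a = 0 and b = 1]) auto
qed

section \<open>Almost sure convergence of the value functions\<close>

theorem theorem2:
  fixes S :: "(real ^ 'm) set"
    and A :: "(real ^ 'n) set"
    and \<xi> :: "'j::finite \<Rightarrow> real ^ 'k"
    and C :: "real ^ 'm \<Rightarrow> real ^ 'n \<Rightarrow> real ^ 'k \<Rightarrow> real"
    and g :: "real ^ 'm \<Rightarrow> real ^ 'n \<Rightarrow> real ^ 'k \<Rightarrow> real ^ 'm"
    and w :: "real ^ 'm \<Rightarrow> real"
    and Pc :: "real ^ 'j"
    and \<tau>0 :: "'j \<Rightarrow> real"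
    and \<gamma> \<alpha> Cw \<kappa>w :: real
    and M :: "'w measure"
    and X :: "nat \<Rightarrow> 'w \<Rightarrow> real ^ 'k"
  assumes "closed S" and "S \<noteq> {}"
    and "closed A" and "A \<noteq> {}"
    and "inj \<xi>"
    and "\<forall>s\<in>S. \<forall>a\<in>A. \<forall>x\<in>range \<xi>. g s a x \<in> S"
    and "0 \<le> \<gamma>" and "\<gamma> < 1"
    and "Pc \<in> prob_vectors"
    and "\<forall>j. 1 < \<tau>0 j"
    and "0 < \<alpha>" and "\<alpha> < 1"
    and "prob_space M"
    and "prob_space.indep_vars M (\<lambda>_. count_space (range \<xi>)) X {1..}"
    and "\<forall>i\<ge>1. \<forall>j. measure M {\<omega> \<in> space M. X i \<omega> = \<xi> j} = Pc $ j"
    and "continuous_on S w" and "\<forall>s\<in>S. 1 \<le> w s"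
    and "compact A"
    and "\<forall>x\<in>range \<xi>. continuous_on (S \<times> A) (\<lambda>(s, a). C s a x)"
    and "\<forall>x\<in>range \<xi>. continuous_on (S \<times> A) (\<lambda>(s, a). g s a x)"
    and "0 < Cw" and "0 \<le> \<kappa>w"
    and "\<forall>s\<in>S. \<forall>a\<in>A. \<forall>x\<in>range \<xi>. \<bar>C s a x\<bar> \<le> Cw * w s \<and> w (g s a x) \<le> \<kappa>w * w s"
    and "\<gamma> * \<kappa>w < 1"
  shows "(\<exists>!V. V \<in> weighted_space S w \<and> bellman S A \<xi> C g \<gamma> Pc V = V) \<and>
    (\<forall>N. \<forall>\<omega>\<in>space M. \<exists>!V. V \<in> weighted_space S w \<and>
        bayes_bellman S A \<xi> C g \<gamma> \<alpha> \<tau>0 X N \<omega> V = V) \<and>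
    (AE \<omega> in M.
      (\<lambda>N. wnorm S w (\<lambda>s. fixed_point S w (bayes_bellman S A \<xi> C g \<gamma> \<alpha> \<tau>0 X N \<omega>) s
                        - fixed_point S w (bellman S A \<xi> C g \<gamma> Pc) s))
        \<longlonglongrightarrow> 0)"
proof -
  interpret prob_space M by fact
  interpret weighted_mdp S A \<xi> C g w \<gamma> Cw \<kappa>w
  proof
    show "0 < w s" if "s \<in> S" for s
      using \<open>\<forall>s\<in>S. 1 \<le> w s\<close> that by force
  qed (use assms in auto)
  let ?Q = "\<lambda>N \<omega>. ambiguity_set (p_hat \<xi> \<tau>0 X N \<omega>) (r_hat \<alpha> \<xi> \<tau>0 X N \<omega>)"
  have Q: "?Q N \<omega> \<noteq> {}" "?Q N \<omega> \<subseteq> prob_vectors" for N \<omega>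
    using assms by (intro bayes_ambiguity_set_nonempty ambiguity_set_subset; simp)+
  have Pc: "{Pc} \<noteq> {}" "{Pc} \<subseteq> prob_vectors"
    using \<open>Pc \<in> prob_vectors\<close> by auto
  \<comment> \<open>Holds for every outcome, not just almost surely, since measurability into
    \<open>count_space (range \<xi>)\<close> includes that values lie in this space.\<close>
  have range: "X i \<omega> \<in> range \<xi>" if "i \<ge> 1" "\<omega> \<in> space M" for i \<omega>
  proof -
    have "X i \<in> M \<rightarrow>\<^sub>M count_space (range \<xi>)"
      using \<open>indep_vars _ X _\<close> \<open>i \<ge> 1\<close> by (auto simp: indep_vars_def)
    from measurable_space[OF this \<open>\<omega> \<in> space M\<close>] show ?thesis by simp
  qed
  \<comment> \<open>The only probabilistic input; the rest is deterministic for a fixed outcome with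
    convergent frequencies.\<close>
  have "AE \<omega> in M. \<forall>j. (\<lambda>N. (\<Sum>i=1..N. if X i \<omega> = \<xi> j then 1 else (0::real)) / real N) \<longlonglongrightarrow> Pc $ j"
    using assms by (intro AE_empirical_frequency_tendsto) auto
  then have "AE \<omega> in M. (\<lambda>N. wnorm S w (\<lambda>s. fixed_point S w (RB (?Q N \<omega>)) s
      - fixed_point S w (RB {Pc}) s)) \<longlonglongrightarrow> 0"
  proof (rule AE_mp, intro AE_I2 impI)
    fix \<omega> assume \<omega>: "\<omega> \<in> space M"
      and freq: "\<forall>j. (\<lambda>N. (\<Sum>i=1..N. if X i \<omega> = \<xi> j then 1 else (0::real)) / real N) \<longlonglongrightarrow> Pc $ j"
    let ?p = "\<lambda>N. p_hat \<xi> \<tau>0 X N \<omega>" and ?r = "\<lambda>N. r_hat \<alpha> \<xi> \<tau>0 X N \<omega>"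
    have p: "(\<lambda>N. ?p N $ j) \<longlonglongrightarrow> Pc $ j" for j
      using range \<omega> freq \<open>inj \<xi>\<close> by (intro p_hat_tendsto) auto
    have r: "(\<lambda>N. ?r N $ j) \<longlonglongrightarrow> 0" for j
      using range \<omega> \<open>inj \<xi>\<close> by (intro r_hat_tendsto_0[OF _ _ p]) auto
    show "(\<lambda>N. wnorm S w (\<lambda>s. fixed_point S w (RB (?Q N \<omega>)) s
        - fixed_point S w (RB {Pc}) s)) \<longlonglongrightarrow> 0"
    proof (rule wnorm_fixed_point_diff_tendsto_0[OF Q \<open>Pc \<in> prob_vectors\<close>])
      \<comment> \<open>The witness for \<delta> comes from the triangle inequality through the
        centre: radius plus estimation error, summed over the support.\<close>
      fix N P assume "P \<in> ?Q N \<omega>"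
      then have "\<bar>P $ j - ?p N $ j\<bar> \<le> ?r N $ j" for j
        by (auto simp: ambiguity_set_def abs_le_iff algebra_simps)
      then have "\<bar>P $ j - Pc $ j\<bar> \<le> ?r N $ j + \<bar>?p N $ j - Pc $ j\<bar>" for j
        by (smt (verit))
      then show "(\<Sum>j\<in>UNIV. \<bar>P $ j - Pc $ j\<bar>) \<le> (\<Sum>j\<in>UNIV. ?r N $ j + \<bar>?p N $ j - Pc $ j\<bar>)"
        by (rule sum_mono)
    next
      have "(\<lambda>N. \<Sum>j\<in>UNIV. ?r N $ j + \<bar>?p N $ j - Pc $ j\<bar>)
          \<longlonglongrightarrow> (\<Sum>j\<in>UNIV. 0 + \<bar>Pc $ j - Pc $ j\<bar>)"
        by (intro tendsto_intros p r)
      then show "(\<lambda>N. \<Sum>j\<in>UNIV. ?r N $ j + \<bar>?p N $ j - Pc $ j\<bar>) \<longlonglongrightarrow> 0"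
        by simp
    qed
  qed
  then show ?thesis
    unfolding bayes_bellman_def bellman_eq_robust
    using RB_unique_fixed_point[OF Pc] RB_unique_fixed_point[OF Q] by blast
qed

end
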